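(* Let $q$ be an odd prime power, let $0\leqslant j\leqslant q-2$ and let $n$ be an integer with $2\leqslant n\leqslant 4$. Then the matrix $M(j,n,q,t)$ is diagonalizable over $\mathbb{C}_\infty$.
   Context: Let $q$ be a power of a prime $p$, and let $\mathbb{C}_\infty$ be the completion of an algebraic closure of $\mathbb{F}_q((1/t))$. For integers $0\leqslant j\leqslant q-2$ and $n\geqslant 1$, $M(j,n,q)=(m_{a,b})_{1\leqslant a,b\leqslant n}$ is the $n\times n$ matrix over $\mathbb{F}_p$ with entries (binomial coefficients reduced modulo $p$, with $\binom{x}{y}=0$ for integers $0\leqslant x<y$) $$m_{a,b}=-\left[\binom{j+(n-a)(q-1)}{j+(n-b)(q-1)}+(-1)^{j+1}\binom{j+(n-a)(q-1)}{j+(b-1)(q-1)}\right]\ \text{ if } a\neq b,\qquad m_{a,a}=(-1)^{j+2}\binom{j+(n-a)(q-1)}{j+(a-1)(q-1)}.$$ $M(j,n,q,t)$ is the $n\times n$ matrix over $\mathbb{F}_q[t]$ whose $(a,b)$ entry is $m_{a,b}\,t^{\,j+1+(b-1)(q-1)}$. (It is the matrix of the Atkin operator $U_t$, normalized by a power of $t$, acting on a block of $\Gamma_0(t)$-invariant Drinfeld cusp forms of weight $k=2j+2+(n-1)(q-1)$.) *)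

theory Defs
  imports
    "HOL-Analysis.Analysis"
    "HOL-Algebra.Algebraic_Closure_Type"
    "HOL-Computational_Algebra.Computational_Algebra"
    "HOL-Number_Theory.Prime_Powers"
    "Jordan_Normal_Form.Matrix"
begin

text \<open>
  The field \<open>\<bbbF>\<^sub>q((1/t))\<close> is the type \<^typ>\<open>'a fls\<close> of formal Laurent series over a finite
  field \<^typ>\<open>'a\<close> with \<open>q\<close> elements, with \<^const>\<open>fls_X\<close> in the role of \<open>1/t\<close>; hence \<open>t\<close> is
  \<^const>\<open>fls_X_inv\<close>. The library metric on \<^typ>\<open>'a fls\<close> is the one of the absolute value with
  \<open>\<bar>t\<bar> = 2\<close>. The usual normalization \<open>\<bar>t\<bar> = q\<close> is a power of it, so it has the same Cauchy
  sequences and the same completion.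

  The locale says that \<^typ>\<open>'c\<close>, with the embedding \<open>emb\<close>, is the completion of the algebraic
  closure of \<open>\<bbbF>\<^sub>q((1/t))\<close>: a complete field (completeness is the class \<^class>\<open>complete_space\<close>)
  whose metric comes from a non-archimedean absolute value \<open>\<lambda>x. dist x 0\<close>, and which contains the
  algebraic closure as a dense subfield on which this absolute value extends the one of
  \<open>\<bbbF>\<^sub>q((1/t))\<close>. As that extension is unique, this determines \<^typ>\<open>'c\<close> up to isometric isomorphism.
\<close>

locale C_infinity = field_hom emb
  for emb :: "'a :: {field, finite} fls alg_closure \<Rightarrow> 'c :: {field, complete_space}" +
  assumes dist_diff: "\<And>x y :: 'c. dist x y = dist (x - y) 0"
    and abs_mult: "\<And>x y :: 'c. dist (x * y) 0 = dist x 0 * dist y 0"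
    and abs_add: "\<And>x y :: 'c. dist (x + y) 0 \<le> max (dist x 0) (dist y 0)"
    and abs_emb: "\<And>f :: 'a fls. dist (emb (to_ac f)) 0 = dist f 0"
    and dense_emb: "closure (range emb) = UNIV"

definition poly_to_C_infinity ::
  "('a :: {field, finite} fls alg_closure \<Rightarrow> 'c :: {field, complete_space}) \<Rightarrow> 'a poly \<Rightarrow> 'c"
  where "poly_to_C_infinity emb P =
    Polynomial.poly (map_poly (\<lambda>c. emb (to_ac (fls_const c))) P) (emb (to_ac fls_X_inv))"

text \<open>The indices \<open>a, b\<close> below run from 1 to \<open>n\<close>, so no subtraction is truncated.\<close>

definition m_entry :: "nat \<Rightarrow> nat \<Rightarrow> nat \<Rightarrow> nat \<Rightarrow> nat \<Rightarrow> int" where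
  "m_entry j n q a b =
    (if a \<noteq> b
     then - (int ((j + (n - a) * (q - 1)) choose (j + (n - b) * (q - 1)))
             + (-1) ^ (j + 1) * int ((j + (n - a) * (q - 1)) choose (j + (b - 1) * (q - 1))))
     else (-1) ^ (j + 2) * int ((j + (n - a) * (q - 1)) choose (j + (a - 1) * (q - 1))))"

text \<open>
  Matrix positions are numbered from 0. The entries of \<open>M_mat\<close> are images of integers, so they lie
  in the prime field \<open>\<bbbF>\<^sub>p\<close> of \<^typ>\<open>'a\<close>.
\<close>

definition M_mat :: "nat \<Rightarrow> nat \<Rightarrow> nat \<Rightarrow> 'a :: field mat" where
  "M_mat j n q = mat n n (\<lambda>(i, k). of_int (m_entry j n q (i + 1) (k + 1)))"

definition M_mat_t :: "nat \<Rightarrow> nat \<Rightarrow> nat \<Rightarrow> 'a :: field poly mat" where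
  "M_mat_t j n q = mat n n (\<lambda>(i, k). Polynomial.monom (M_mat j n q $$ (i, k)) (j + 1 + k * (q - 1)))"

definition diagonalizable_mat :: "'b :: field mat \<Rightarrow> bool" where
  "diagonalizable_mat A \<longleftrightarrow> (\<exists>D. diagonal_mat D \<and> similar_mat A D)"

end

theory Submission
  imports Defs "HOL-Number_Theory.Residues" "Jordan_Normal_Form.Determinant"
begin

text \<open>
  Modulo \<open>p\<close>, Lucas' theorem evaluates the binomial coefficients in \<open>M(j, n, q)\<close>. If \<open>n \<le> j + 1\<close>,
  only the antidiagonal survives, and \<open>M(j, n, q, t)\<close> squares to the scalar \<open>w\<^sup>2\<close>, where \<open>w\<close> is the
  power of \<open>t\<close> with exponent \<open>j + 1 + (n - 1) (q - 1) / 2\<close>, an integer as \<open>q\<close> is odd. Each of the six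
  remaining pairs \<open>(n, j)\<close> gives a fixed sparse matrix whose eigenvalues are explicit polynomials
  in \<open>t\<close> and \<open>w\<close>; they are pairwise distinct, mostly because their absolute values differ.
\<close>

section \<open>Diagonalizability from eigenvectors\<close>

text \<open>Throughout this section, \<open>v i k\<close> is the \<open>i\<close>-th coordinate of the \<open>k\<close>-th eigenvector.\<close>

lemma diagonalizable_mat_eigenbasis:
  fixes A :: "nat \<Rightarrow> nat \<Rightarrow> 'b :: field" and v :: "nat \<Rightarrow> nat \<Rightarrow> 'b" and l :: "nat \<Rightarrow> 'b"
  assumes eig: "\<And>i k. i < n \<Longrightarrow> k < n \<Longrightarrow> (\<Sum>m<n. A i m * v m k) = v i k * l k"
    and indep: "\<And>c k. (\<And>i. i < n \<Longrightarrow> (\<Sum>k<n. v i k * c k) = 0) \<Longrightarrow> k < n \<Longrightarrow> c k = 0"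
  shows "diagonalizable_mat (mat n n (\<lambda>(i, k). A i k))"
proof -
  define M where "M = mat n n (\<lambda>(i, k). A i k)"
  define P where "P = mat n n (\<lambda>(i, k). v i k)"
  define D where "D = mat n n (\<lambda>(i, k). if i = k then l k else 0)"
  have carr: "M \<in> carrier_mat n n" "P \<in> carrier_mat n n" "D \<in> carrier_mat n n"
    by (auto simp: M_def P_def D_def)
  have "det P \<noteq> 0"
  proof
    assume "det P = 0"
    then obtain u where u: "u \<in> carrier_vec n" "u \<noteq> 0\<^sub>v n" "P *\<^sub>v u = 0\<^sub>v n"
      using det_0_iff_vec_prod_zero_field[OF carr(2)] by auto
    have "(\<Sum>k<n. v i k * u $ k) = 0" if "i < n" for i
    proof -
      have "(P *\<^sub>v u) $ i = (\<Sum>k<n. v i k * u $ k)"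
        using that u(1) by (auto simp: P_def scalar_prod_def lessThan_atLeast0 intro!: sum.cong)
      thus ?thesis using u(3) that by simp
    qed
    hence "u $ k = 0" if "k < n" for k
      using indep[of "\<lambda>k. u $ k"] that by blast
    hence "u = 0\<^sub>v n"
      using u(1) by (intro eq_vecI) auto
    thus False using u(2) by blast
  qed
  then obtain Q where Q: "Q \<in> carrier_mat n n" "Q * P = 1\<^sub>m n" "P * Q = 1\<^sub>m n"
    using det_non_zero_imp_unit[OF carr(2), of "()"]
    by (auto simp: Units_def ring_mat_def)
  have MP: "M * P = P * D"
  proof (rule eq_matI)
    fix i k assume "i < dim_row (P * D)" "k < dim_col (P * D)"
    hence ik: "i < n" "k < n" using carr by auto
    have "(M * P) $$ (i, k) = (\<Sum>m<n. A i m * v m k)"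
      using ik by (auto simp: M_def P_def scalar_prod_def lessThan_atLeast0 intro!: sum.cong)
    also have "\<dots> = (\<Sum>m<n. v i m * (if m = k then l k else 0))"
      using ik by (simp add: eig if_distrib cong: if_cong)
    also have "\<dots> = (P * D) $$ (i, k)"
      using ik by (auto simp: D_def P_def scalar_prod_def lessThan_atLeast0 intro!: sum.cong)
    finally show "(M * P) $$ (i, k) = (P * D) $$ (i, k)" .
  qed (use carr in auto)
  have "M = M * (P * Q)" using carr Q by simp
  also have "\<dots> = M * P * Q" using carr Q by (simp add: assoc_mult_mat)
  finally have "M = P * D * Q" by (simp add: MP)
  hence "similar_mat M D"
    by (intro similar_matI[of _ _ P Q n]) (use carr Q in auto)
  moreover have "diagonal_mat D" by (auto simp: D_def diagonal_mat_def)
  ultimately show ?thesis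
    unfolding diagonalizable_mat_def M_def[symmetric] by blast
qed

lemma diagonalizable_mat_distinct_eigenvalues:
  fixes A :: "nat \<Rightarrow> nat \<Rightarrow> 'b :: field" and v :: "nat \<Rightarrow> nat \<Rightarrow> 'b" and l :: "nat \<Rightarrow> 'b"
  assumes eig: "\<And>i k. i < n \<Longrightarrow> k < n \<Longrightarrow> (\<Sum>m<n. A i m * v m k) = v i k * l k"
    and nz: "\<And>k. k < n \<Longrightarrow> \<exists>i<n. v i k \<noteq> 0"
    and inj: "inj_on l {..<n}"
  shows "diagonalizable_mat (mat n n (\<lambda>(i, k). A i k))"
proof (rule diagonalizable_mat_eigenbasis[OF eig])
  fix c :: "nat \<Rightarrow> 'b" and k
  assume ker: "\<And>i. i < n \<Longrightarrow> (\<Sum>k<n. v i k * c k) = 0" and k: "k < n"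
  \<comment> \<open>Applying \<open>A - l a\<close> to a vanishing combination of the eigenvectors multiplies its
    coefficients by \<open>l k - l a\<close>.\<close>
  have prods: "\<forall>i<n. (\<Sum>k<n. v i k * (c k * (\<Prod>a\<in>L. l k - l a))) = 0" if "finite L" for L
    using that
  proof (induction L)
    case empty
    show ?case using ker by simp
  next
    case (insert a L)
    define g where "g k = c k * (\<Prod>a\<in>L. l k - l a)" for k
    have g0: "(\<Sum>k<n. v i k * g k) = 0" if "i < n" for i
      using insert.IH that by (simp add: g_def)
    show ?case
    proof (intro allI impI)
      fix i assume i: "i < n"
      have "(\<Sum>k<n. v i k * (c k * (\<Prod>a\<in>insert a L. l k - l a)))
          = (\<Sum>k<n. v i k * l k * g k) - l a * (\<Sum>k<n. v i k * g k)"
        using insert.hyps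
        by (simp add: g_def sum_distrib_left sum_subtractf[symmetric] algebra_simps)
      also have "(\<Sum>k<n. v i k * l k * g k) = (\<Sum>k<n. \<Sum>m<n. A i m * (v m k * g k))"
        using i by (intro sum.cong refl) (simp add: eig[symmetric] sum_distrib_right mult.assoc)
      also have "\<dots> = (\<Sum>m<n. A i m * (\<Sum>k<n. v m k * g k))"
        by (subst sum.swap) (simp add: sum_distrib_left)
      also have "\<dots> = 0" by (simp add: g0)
      finally show "(\<Sum>k<n. v i k * (c k * (\<Prod>a\<in>insert a L. l k - l a))) = 0"
        using i by (simp add: g0)
    qed
  qed
  \<comment> \<open>For \<open>L\<close> consisting of all indices but \<open>k\<close>, only the
    term of index \<open>k\<close> survives; its factor \<open>\<pi>\<close> is nonzero because the
    eigenvalues are distinct.\<close>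
  define \<pi> where "\<pi> = (\<Prod>a\<in>{..<n} - {k}. l k - l a)"
  obtain i where i: "i < n" "v i k \<noteq> 0" using nz[OF k] by blast
  have "(\<Prod>a\<in>{..<n} - {k}. l m - l a) = (if m = k then \<pi> else 0)" if "m < n" for m
    using that by (auto simp: \<pi>_def intro!: prod_zero)
  hence "(\<Sum>m<n. v i m * (c m * (\<Prod>a\<in>{..<n} - {k}. l m - l a)))
      = (\<Sum>m<n. if m = k then v i k * (c k * \<pi>) else 0)"
    by (intro sum.cong) auto
  hence "v i k * (c k * \<pi>) = 0"
    using prods[of "{..<n} - {k}"] i(1) k by simp
  moreover have "\<pi> \<noteq> 0"
    using inj k by (auto simp: \<pi>_def inj_on_def)
  ultimately show "c k = 0" using i(2) by simp
qed

text \<open>With \<open>k' = n - 1 - k\<close>, the matrix sends the basis vector \<open>e_k\<close>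
  to \<open>x k * e_k'\<close> and \<open>e_k'\<close> to \<open>x k' * e_k\<close>. Hence it
  squares to \<open>w\<^sup>2\<close>, and \<open>w * e_k + x k * e_k'\<close> and
  \<open>w * e_k - x k * e_k'\<close> are eigenvectors for \<open>w\<close> and
  \<open>- w\<close>.\<close>

lemma diagonalizable_mat_antidiagonal:
  fixes x :: "nat \<Rightarrow> 'b :: field" and w :: 'b
  assumes sq: "\<And>k. k < n \<Longrightarrow> x k * x (n - 1 - k) = w\<^sup>2"
    and w: "w \<noteq> 0" and two: "(2 :: 'b) \<noteq> 0"
  shows "diagonalizable_mat (mat n n (\<lambda>(i, k). if i = n - 1 - k then x k else 0))"
proof -
  define \<sigma> where "\<sigma> k = (if 2 * k + 1 < n then 1 else if n < 2 * k + 1 then - 1 else x k / w)" for k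
  define v where "v i k = (if i = k then w else 0) + (if i = n - 1 - k then \<sigma> k * x k else 0)" for i k
  have mid: "x k * x k = w * w" if "2 * k + 1 = n" for k
  proof -
    have "n - 1 - k = k" "k < n" using that by auto
    thus ?thesis using sq[of k] by (simp add: power2_eq_square)
  qed
  have \<sigma>2: "\<sigma> k * \<sigma> k = 1" if "k < n" for k
    using mid[of k] w by (auto simp: \<sigma>_def)
  have sumk: "(\<Sum>m<n. f m * v m k) = f k * w + f (n - 1 - k) * (\<sigma> k * x k)" if "k < n" for f k
  proof -
    have "(\<Sum>m<n. f m * v m k)
      = (\<Sum>m<n. (if m = k then f k * w else 0) + (if m = n - 1 - k then f (n - 1 - k) * (\<sigma> k * x k) else 0))"
      by (intro sum.cong) (auto simp: v_def algebra_simps)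
    thus ?thesis using that by (simp add: sum.distrib)
  qed
  show ?thesis
  proof (rule diagonalizable_mat_eigenbasis[where v = v and l = "\<lambda>k. \<sigma> k * w"])
    fix i k assume ik: "i < n" "k < n"
    define k' where "k' = n - 1 - k"
    have k': "n - 1 - k' = k" "x k * x k' = w\<^sup>2" using ik sq[of k] by (auto simp: k'_def)
    have "(\<Sum>m<n. (if i = n - 1 - m then x m else 0) * v m k)
        = (if i = k' then x k else 0) * w + (if i = k then x k' else 0) * (\<sigma> k * x k)"
      unfolding sumk[OF ik(2)] k'_def[symmetric] k'(1) ..
    also have "\<dots> = v i k * (\<sigma> k * w)"
    proof -
      have "(if i = k then x k' else 0) * (\<sigma> k * x k) = (if i = k then w else 0) * (\<sigma> k * w)"
        using k'(2) by (simp add: power2_eq_square algebra_simps)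
      moreover have "(if i = k' then x k else 0) * w = (if i = k' then \<sigma> k * x k else 0) * (\<sigma> k * w)"
      proof -
        have "\<sigma> k * x k * (\<sigma> k * w) = (\<sigma> k * \<sigma> k) * (x k * w)" by (simp add: algebra_simps)
        thus ?thesis using \<sigma>2[OF ik(2)] by simp
      qed
      ultimately show ?thesis
        unfolding v_def k'_def[symmetric] distrib_right by (simp only: add.commute)
    qed
    finally show "(\<Sum>m<n. (if i = n - 1 - m then x m else 0) * v m k) = v i k * (\<sigma> k * w)" .
  next
    fix c :: "nat \<Rightarrow> 'b" and k
    assume ker: "\<And>i. i < n \<Longrightarrow> (\<Sum>k<n. v i k * c k) = 0" and k: "k < n"
    have row: "w * c i + \<sigma> (n - 1 - i) * x (n - 1 - i) * c (n - 1 - i) = 0" if "i < n" for i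
    proof -
      have "(\<Sum>k<n. v i k * c k) = (\<Sum>k<n. (if k = i then w * c i else 0)
          + (if k = n - 1 - i then \<sigma> (n - 1 - i) * x (n - 1 - i) * c (n - 1 - i) else 0))"
        using that by (intro sum.cong) (auto simp: v_def algebra_simps)
      thus ?thesis using ker[OF that] that by (simp add: sum.distrib)
    qed
    define k' where "k' = n - 1 - k"
    have k': "n - 1 - k' = k" "k' < n" "x k * x k' = w * w"
      using k sq[of k] by (auto simp: k'_def power2_eq_square)
    have r1: "w * c k + \<sigma> k' * x k' * c k' = 0" using row[OF k] by (simp add: k'_def)
    have r2: "w * c k' + \<sigma> k * x k * c k = 0" using row[OF k'(2)] unfolding k'(1) .
    show "c k = 0"
    proof (cases "2 * k + 1 = n")
      case True
      hence "k' = k" by (auto simp: k'_def)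
      hence "w * (w * c k) + (x k * x k) * c k = 0"
        using arg_cong[OF r1, of "\<lambda>z. w * z"] True w by (simp add: \<sigma>_def algebra_simps)
      hence "2 * (w * w) * c k = 0" using mid[OF True] by (simp add: algebra_simps)
      thus ?thesis using two w by simp
    next
      case False
      hence "\<sigma> k' * \<sigma> k = - 1" using k by (auto simp: \<sigma>_def k'_def)
      \<comment> \<open>Eliminating \<open>c k'\<close> from \<open>r1\<close> and
        \<open>r2\<close>: the opposite signs turn the determinant of this two by two system into
        \<open>2 * (w * w)\<close>.\<close>
      moreover have "w * (w * c k) - (\<sigma> k' * \<sigma> k) * (x k * x k') * c k
          = w * (w * c k + \<sigma> k' * x k' * c k') - \<sigma> k' * x k' * (w * c k' + \<sigma> k * x k * c k)"
        by (simp add: algebra_simps)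
      ultimately have "2 * (w * w) * c k = 0" unfolding r1 r2 k'(3) by (simp add: algebra_simps)
      thus ?thesis using two w by simp
    qed
  qed
qed

section \<open>Small matrices with distinct eigenvalues\<close>

text \<open>Literal lists let the eigenvector equations be verified entry by entry. The matrix is
  listed by rows, but each member of \<open>evs\<close> is a column vector.\<close>

lemma diagonalizable_mat_lists:
  fixes rows evs :: "'b :: field list list" and ls :: "'b list"
  assumes "length evs = n" "length ls = n" "distinct ls"
    and eig: "\<And>i k. i < n \<Longrightarrow> k < n \<Longrightarrow> (\<Sum>m<n. rows ! i ! m * evs ! k ! m) = evs ! k ! i * ls ! k"
    and nz: "\<And>e. e \<in> set evs \<Longrightarrow> length e = n \<and> (\<exists>x\<in>set e. x \<noteq> 0)"
  shows "diagonalizable_mat (mat n n (\<lambda>(i, k). rows ! i ! k))"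
proof (rule diagonalizable_mat_distinct_eigenvalues[where v = "\<lambda>i k. evs ! k ! i" and l = "(!) ls"])
  show "\<exists>i<n. evs ! k ! i \<noteq> 0" if "k < n" for k
    using nz[of "evs ! k"] assms(1) that by (metis in_set_conv_nth)
  show "inj_on ((!) ls) {..<n}"
    using assms by (intro inj_on_nth) auto
qed (rule eig)

text \<open>
  The suffix of a name below is the pair \<open>n, j\<close> whose matrix is treated; \<open>d1, d2, \<dots>\<close> stand for the
  powers of \<open>t\<close> in the columns, and \<open>evs ! k\<close> is an eigenvector for \<open>ls ! k\<close>.
\<close>

lemma diagonalizable_mat_2_0:
  fixes d1 :: "'b :: field"
  assumes "d1 \<noteq> 0"
  shows "diagonalizable_mat (mat 2 2 (\<lambda>(i, k). [[d1, 0], [d1, 0]] ! i ! k))"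
proof (rule diagonalizable_mat_lists[where evs = "[[1, 1], [0, 1]]" and ls = "[d1, 0]"])
  fix i k :: nat assume "i < 2" "k < 2"
  then show "(\<Sum>m<2. [[d1, 0], [d1, 0]] ! i ! m * [[1, 1], [0, 1]] ! k ! m)
      = [[1, 1], [0, 1]] ! k ! i * [d1, 0] ! k"
    by (auto simp: numeral_eq_Suc less_Suc_eq)
qed (use assms in auto)

text \<open>The last two basis vectors span an invariant subspace with eigenvalues \<open>d2\<close>
  and 0; the quotient contributes \<open>d1\<close>.\<close>

lemma diagonalizable_mat_3_0:
  fixes d1 d2 d3 :: "'b :: field"
  assumes "d1 \<noteq> 0" "d2 \<noteq> 0" "d1 \<noteq> d2"
  shows "diagonalizable_mat (mat 3 3 (\<lambda>(i, k). [[d1, 0, 0], [d1, d2, - d3], [d1, 0, 0]] ! i ! k))"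
    (is "diagonalizable_mat (mat 3 3 (\<lambda>(i, k). ?R ! i ! k))")
proof (rule diagonalizable_mat_lists)
  let ?E = "[[d1 - d2, d1 - d3, d1 - d2], [0, 1, 0], [0, d3, d2]]"
  let ?l = "[d1, d2, 0]"
  show "(\<Sum>m<3. ?R ! i ! m * ?E ! k ! m) = ?E ! k ! i * ?l ! k" if "i < 3" "k < 3" for i k
    using that by (auto simp: numeral_eq_Suc less_Suc_eq algebra_simps)
  show "length e = 3 \<and> (\<exists>x\<in>set e. x \<noteq> 0)" if "e \<in> set ?E" for e
    using that assms by auto
qed (use assms in auto)

text \<open>The last basis vector spans the kernel, and the matrix induced on the quotient is upper
  triangular with diagonal \<open>d1\<close>, \<open>- d2\<close>.\<close>

lemma diagonalizable_mat_3_1: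
  fixes d1 d2 :: "'b :: field"
  assumes "d1 \<noteq> 0" "d2 \<noteq> 0" "d1 \<noteq> - d2" "(2 :: 'b) \<noteq> 0"
  shows "diagonalizable_mat (mat 3 3 (\<lambda>(i, k). [[d1, - 2 * d2, 0], [0, - d2, 0], [- d1, 0, 0]] ! i ! k))"
    (is "diagonalizable_mat (mat 3 3 (\<lambda>(i, k). ?R ! i ! k))")
proof (rule diagonalizable_mat_lists)
  let ?E = "[[1, 0, - 1], [2 * d2, d1 + d2, 2 * d1], [0, 0, 1]]"
  let ?l = "[d1, - d2, 0]"
  show "(\<Sum>m<3. ?R ! i ! m * ?E ! k ! m) = ?E ! k ! i * ?l ! k" if "i < 3" "k < 3" for i k
    using that by (auto simp: numeral_eq_Suc less_Suc_eq algebra_simps)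
  show "length e = 3 \<and> (\<exists>x\<in>set e. x \<noteq> 0)" if "e \<in> set ?E" for e
    using that assms by auto
qed (use assms in auto)

lemma minus_neq_self:
  fixes w :: "'b :: field"
  assumes "w \<noteq> 0" "(2 :: 'b) \<noteq> 0"
  shows "w \<noteq> - w"
proof
  assume "w = - w"
  hence "2 * w = 0" by (metis mult_2 add.right_inverse)
  thus False using assms by simp
qed

lemma less_4_cases: "i < 4 \<Longrightarrow> i = 0 \<or> i = Suc 0 \<or> i = Suc (Suc 0) \<or> i = Suc (Suc (Suc 0))"
  by arith

lemma sum_lessThan_4:
  "(\<Sum>m<4. f m) = f 0 + f (Suc 0) + f (Suc (Suc 0)) + (f (Suc (Suc (Suc 0))) :: 'b :: comm_monoid_add)"
  by (simp add: numeral_eq_Suc)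

text \<open>The two middle basis vectors span an invariant subspace on which the matrix is
  antidiagonal with square \<open>w * w\<close>. Adding the last basis vector gives the eigenvalue
  0, and the remaining quotient gives \<open>d1\<close>.\<close>

lemma diagonalizable_mat_4_0:
  fixes d1 d2 d3 d4 w :: "'b :: field"
  assumes W: "d2 * d3 = w * w"
    and nz: "d1 \<noteq> 0" "d2 \<noteq> 0" "w \<noteq> 0" "d1 \<noteq> w" "d1 \<noteq> - w" "(2 :: 'b) \<noteq> 0"
  shows "diagonalizable_mat (mat 4 4 (\<lambda>(i, k).
    [[d1, 0, 0, 0], [d1, 0, d3, - d4], [d1, d2, 0, - d4], [d1, 0, 0, 0]] ! i ! k))"
    (is "diagonalizable_mat (mat 4 4 (\<lambda>(i, k). ?R ! i ! k))")
proof (rule diagonalizable_mat_lists)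
  let ?D = "d1 * d1 - w * w"
  \<comment> \<open>The eigenvector for \<open>d1\<close> is scaled by \<open>?D\<close>, the
    determinant of the linear system for its two middle coordinates, so that no division
    occurs.\<close>
  let ?E = "[[?D, (d1 - d4) * (d1 + d3), (d1 - d4) * (d1 + d2), ?D],
    [0, w, d2, 0], [0, - w, d2, 0], [0, d4 * d3, d4 * d2, w * w]]"
  let ?l = "[d1, w, - w, 0]"
  \<comment> \<open>\<open>W\<close> with a trailing factor, as it occurs inside longer products
    bracketed to the right.\<close>
  have W': "d2 * (d3 * x) = w * (w * x)" for x
    using W by (metis mult.assoc)
  show "(\<Sum>m<4. ?R ! i ! m * ?E ! k ! m) = ?E ! k ! i * ?l ! k" if "i < 4" "k < 4" for i k
    by (insert less_4_cases[OF that(1)] less_4_cases[OF that(2)],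
      elim disjE; hypsubst_thin; simp only: sum_lessThan_4 nth_Cons_0 nth_Cons_Suc)
      (simp_all add: algebra_simps W W')
  have "?D = (d1 - w) * (d1 + w)" by (simp add: algebra_simps)
  moreover have "d1 + w \<noteq> 0" using nz(5) by (simp add: eq_neg_iff_add_eq_0)
  ultimately have "?D \<noteq> 0" using nz(4) by simp
  then show "length e = 4 \<and> (\<exists>x\<in>set e. x \<noteq> 0)" if "e \<in> set ?E" for e
    using that nz by auto
qed (use nz minus_neq_self[of w] in auto)

text \<open>For a nonzero eigenvalue \<open>x\<close>, the last two rows express the last two
  coordinates through the first two, and the difference of the first two rows fixes the ratio of the
  first two coordinates. This produces \<open>E x\<close> below; what remains is a cubic equation in
  \<open>x\<close>, which factors by the relations \<open>W\<close>.\<close>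

lemma diagonalizable_mat_4_1:
  fixes d1 d2 d3 d4 w :: "'b :: field"
  assumes W: "d2 * d3 = w * w" "d1 * d4 = w * w"
    and nz: "d1 \<noteq> d2" "d4 \<noteq> 0" "w \<noteq> 0" "(2 :: 'b) \<noteq> 0"
    and \<mu>: "2 * d1 - d2 \<noteq> 0" "2 * d1 - d2 \<noteq> w" "2 * d1 - d2 \<noteq> - w"
  shows "diagonalizable_mat (mat 4 4 (\<lambda>(i, k).
    [[2 * d1, - 2 * d2, - 2 * d3, d4], [d1, - d2, - 2 * d3, d4], [0, - d2, 0, 0], [- d1, 0, 0, 0]] ! i ! k))"
    (is "diagonalizable_mat (mat 4 4 (\<lambda>(i, k). ?R ! i ! k))")
proof (rule diagonalizable_mat_lists)
  \<comment> \<open>The characteristic polynomial is \<open>X (X - (2 d1 - d2)) (X\<^sup>2 - w\<^sup>2)\<close>.\<close>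
  define E where "E x = [x * (d2 - x), x * (d1 - x), - d2 * (d1 - x), - d1 * (d2 - x)]" for x
  let ?E = "[E (2 * d1 - d2), E w, E (- w), [0, 0, d4, 2 * d3]]"
  let ?l = "[2 * d1 - d2, w, - w, 0]"
  have E: "(\<Sum>m<4. ?R ! i ! m * E x ! m) = E x ! i * x"
    if "i < 4" and root: "(x * x - w * w) * (x - (2 * d1 - d2)) = 0" for i x
  proof -
    \<comment> \<open>\<open>r\<close> is the amount by which the first two rows of the eigenvector
      equation fail for general \<open>x\<close>.\<close>
    define r where "r = (x * x - w * w) * (x - (2 * d1 - d2))"
    have "2 * d1 * (x * (d2 - x)) + - 2 * d2 * (x * (d1 - x)) + - 2 * d3 * (- d2 * (d1 - x))
        + d4 * (- d1 * (d2 - x)) = 2 * d1 * (x * (d2 - x)) - 2 * d2 * (x * (d1 - x))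
        + 2 * (d2 * d3) * (d1 - x) - (d1 * d4) * (d2 - x)"
      by (simp add: algebra_simps)
    also have "\<dots> = x * (d2 - x) * x + r"
      unfolding W r_def by (simp add: algebra_simps)
    finally have row1: "2 * d1 * (x * (d2 - x)) + - 2 * d2 * (x * (d1 - x))
        + - 2 * d3 * (- d2 * (d1 - x)) + d4 * (- d1 * (d2 - x)) = x * (d2 - x) * x"
      by (simp add: r_def root)
    have "d1 * (x * (d2 - x)) + - d2 * (x * (d1 - x)) + - 2 * d3 * (- d2 * (d1 - x))
        + d4 * (- d1 * (d2 - x)) = d1 * (x * (d2 - x)) - d2 * (x * (d1 - x))
        + 2 * (d2 * d3) * (d1 - x) - (d1 * d4) * (d2 - x)"
      by (simp add: algebra_simps)
    also have "\<dots> = x * (d1 - x) * x + r"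
      unfolding W r_def by (simp add: algebra_simps)
    finally have row2: "d1 * (x * (d2 - x)) + - d2 * (x * (d1 - x))
        + - 2 * d3 * (- d2 * (d1 - x)) + d4 * (- d1 * (d2 - x)) = x * (d1 - x) * x"
      by (simp add: r_def root)
    show ?thesis
      unfolding E_def
      by (insert less_4_cases[OF that(1)], elim disjE; hypsubst_thin;
        simp only: sum_lessThan_4 nth_Cons_0 nth_Cons_Suc row1 row2)
        (simp_all add: algebra_simps)
  qed
  have N: "(\<Sum>m<4. ?R ! i ! m * [0, 0, d4, 2 * d3] ! m) = [0, 0, d4, 2 * d3] ! i * 0"
    if "i < 4" for i
    by (insert less_4_cases[OF that],
      elim disjE; hypsubst_thin; simp only: sum_lessThan_4 nth_Cons_0 nth_Cons_Suc)
      simp_all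
  show "(\<Sum>m<4. ?R ! i ! m * ?E ! k ! m) = ?E ! k ! i * ?l ! k" if "i < 4" "k < 4" for i k
    using less_4_cases[OF that(2)] E[OF that(1)] N[OF that(1)]
    by (elim disjE; hypsubst; simp only: nth_Cons_0 nth_Cons_Suc) simp_all
  \<comment> \<open>Since \<open>d1 \<noteq> d2\<close>, the factors \<open>d2 - x\<close> and
    \<open>d1 - x\<close> cannot both vanish.\<close>
  have "length (E x) = 4 \<and> (\<exists>z\<in>set (E x). z \<noteq> 0)" if "x \<noteq> 0" for x
    using that nz(1) by (auto simp: E_def)
  then show "length e = 4 \<and> (\<exists>x\<in>set e. x \<noteq> 0)" if "e \<in> set ?E" for e
    using that nz \<mu> by auto
qed (use nz \<mu> minus_neq_self[of w] in auto)

text \<open>The first and last basis vectors span an invariant subspace with eigenvalues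
  \<open>d1\<close> and 0; on the quotient the matrix is antidiagonal with square
  \<open>w * w\<close>.\<close>

lemma diagonalizable_mat_4_2:
  fixes d1 d2 d3 w :: "'b :: field"
  assumes W: "d2 * d3 = w * w"
    and nz: "d1 \<noteq> 0" "d2 \<noteq> 0" "w \<noteq> 0" "d1 \<noteq> w" "d1 \<noteq> - w" "(2 :: 'b) \<noteq> 0"
  shows "diagonalizable_mat (mat 4 4 (\<lambda>(i, k).
    [[d1, - 3 * d2, 3 * d3, 0], [0, 0, d3, 0], [0, d2, 0, 0], [d1, 0, 0, 0]] ! i ! k))"
    (is "diagonalizable_mat (mat 4 4 (\<lambda>(i, k). ?R ! i ! k))")
proof (rule diagonalizable_mat_lists)
  \<comment> \<open>The third vector is the second one with \<open>w\<close> replaced by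
    \<open>- w\<close>. In characteristic 3 their outer coordinates vanish, but the middle ones stay
    nonzero because \<open>d1\<close> is neither \<open>w\<close> nor \<open>- w\<close>.\<close>
  let ?E = "[[1, 0, 0, 1], [3 * w * (w - d2), w * (w - d1), d2 * (w - d1), 3 * d1 * (w - d2)],
    [3 * w * (w + d2), w * (w + d1), - d2 * (w + d1), - 3 * d1 * (w + d2)], [0, 0, 0, 1]]"
  let ?l = "[d1, w, - w, 0]"
  have W': "d2 * (d3 * x) = w * (w * x)" for x
    using W by (metis mult.assoc)
  show "(\<Sum>m<4. ?R ! i ! m * ?E ! k ! m) = ?E ! k ! i * ?l ! k" if "i < 4" "k < 4" for i k
    by (insert less_4_cases[OF that(1)] less_4_cases[OF that(2)],
      elim disjE; hypsubst_thin; simp only: sum_lessThan_4 nth_Cons_0 nth_Cons_Suc)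
      (simp_all add: algebra_simps W W')
  have "w + d1 \<noteq> 0" using nz(5) by (simp add: eq_neg_iff_add_eq_0 add.commute)
  then show "length e = 4 \<and> (\<exists>x\<in>set e. x \<noteq> 0)" if "e \<in> set ?E" for e
    using that nz by auto
qed (use nz minus_neq_self[of w] in auto)

section \<open>Binomial coefficients modulo \<open>p\<close>\<close>

text \<open>Compare coefficients in the Frobenius identity (1 + X)^q = X^q + 1.\<close>

lemma of_nat_prime_power_choose:
  assumes "Factorial_Ring.prime CHAR('b :: field)" "q = CHAR('b) ^ e" "0 < i" "i < q"
  shows "of_nat (q choose i) = (0 :: 'b)"
proof -
  have "([:1, 1:] :: 'b poly) ^ q = Polynomial.monom 1 q + 1"
  proof -
    have "([:1, 1:] :: 'b poly) = Polynomial.monom 1 1 + 1" by (simp add: Polynomial.monom_Suc one_pCons)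
    also have "\<dots> ^ q = Polynomial.monom 1 1 ^ q + 1 ^ q"
      using assms(1,2) by (intro freshmans_dream') simp_all
    finally show ?thesis by (simp add: Polynomial.monom_power)
  qed
  hence "Polynomial.coeff (([:1, 1:] :: 'b poly) ^ q) i = 0"
    using assms(3,4) by simp
  thus ?thesis using assms(4) by (simp add: coeff_linear_poly_power)
qed

text \<open>In Vandermonde's convolution only the terms \<open>i = 0\<close> and
  \<open>i = q\<close> survive; this is (1 + X)^(q + N) = (1 + X^q) (1 + X)^N read off
  coefficientwise.\<close>

lemma of_nat_choose_add_q:
  assumes "0 < q" and frob: "\<And>i. 0 < i \<Longrightarrow> i < q \<Longrightarrow> of_nat (q choose i) = (0 :: 'b :: comm_ring_1)"
  shows "of_nat ((q + N) choose k)
    = (of_nat (N choose k) + (if q \<le> k then of_nat (N choose (k - q)) else 0) :: 'b)"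
proof -
  have "(of_nat ((q + N) choose k) :: 'b) = (\<Sum>i\<le>k. of_nat (q choose i) * of_nat (N choose (k - i)))"
    by (simp flip: vandermonde)
  also have "\<dots> = (\<Sum>i\<le>k. (if i = 0 then of_nat (N choose k) else 0)
      + (if i = q then of_nat (N choose (k - q)) else 0))"
  proof (rule sum.cong[OF refl])
    fix i
    consider "i = 0" | "0 < i" "i < q" | "i = q" "0 < i" | "q < i" by linarith
    thus "(of_nat (q choose i) * of_nat (N choose (k - i)) :: 'b) = (if i = 0 then of_nat (N choose k) else 0)
      + (if i = q then of_nat (N choose (k - q)) else 0)"
      using assms(1) by cases (auto simp: frob binomial_eq_0)
  qed
  also have "\<dots> = of_nat (N choose k) + (if q \<le> k then of_nat (N choose (k - q)) else 0)"
    by (simp add: sum.distrib)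
  finally show ?thesis .
qed

text \<open>Only the lowest base-\<open>q\<close> digit is split off. Raising \<open>m\<close> by
  one adds \<open>q\<close> to the upper argument, and the previous recurrence then becomes Pascal's
  rule for \<open>m choose l\<close>.\<close>

lemma of_nat_choose_Lucas:
  assumes frob: "\<And>i. 0 < i \<Longrightarrow> i < q \<Longrightarrow> of_nat (q choose i) = (0 :: 'b :: comm_ring_1)"
    and "r < q" "s < q"
  shows "of_nat ((m * q + r) choose (l * q + s)) = (of_nat (m choose l) * of_nat (r choose s) :: 'b)"
proof (induction m arbitrary: l)
  case 0
  show ?case using assms(2) by (cases l) (auto simp: binomial_eq_0)
next
  case (Suc m)
  have *: "of_nat ((Suc m * q + r) choose k) = (of_nat ((m * q + r) choose k)
      + (if q \<le> k then of_nat ((m * q + r) choose (k - q)) else 0) :: 'b)" for k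
    using of_nat_choose_add_q[OF _ frob, where N = "m * q + r" and k = k] assms(2)
    by (simp add: add.assoc)
  show ?case
  proof (cases l)
    case 0
    thus ?thesis using *[of s] Suc.IH[of 0] assms(3) by simp
  next
    case (Suc l')
    have "Suc l' * q + s - q = l' * q + s" "q \<le> Suc l' * q + s" by auto
    thus ?thesis
      unfolding Suc * using Suc.IH[of "Suc l'"] Suc.IH[of l'] by (simp add: algebra_simps)
  qed
qed

text \<open>Both binomial coefficients of an entry have this shape: at position
  \<open>(i, k)\<close> counted from 0, \<open>m\<close> is \<open>n - 1 - i\<close> and
  \<open>l\<close> is \<open>n - 1 - k\<close> or \<open>k\<close>.\<close>

definition block_binomial :: "nat \<Rightarrow> nat \<Rightarrow> nat \<Rightarrow> nat \<Rightarrow> 'b :: comm_ring_1" where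
  "block_binomial q j m l = of_nat ((j + m * (q - 1)) choose (j + l * (q - 1)))"

text \<open>
  The base-\<open>q\<close> digits of \<open>j + m (q - 1)\<close> are \<open>(m, j - m)\<close> if \<open>m \<le> j\<close>, and \<open>(m - 1, q + j - m)\<close>
  otherwise. A nonzero binomial coefficient off the diagonal needs \<open>l \<le> j < m\<close>.
\<close>

lemma block_binomial_eq:
  assumes frob: "\<And>i. 0 < i \<Longrightarrow> i < q \<Longrightarrow> of_nat (q choose i) = (0 :: 'b :: comm_ring_1)"
    and q: "2 \<le> q" "m \<le> q" "j < q"
  shows "(block_binomial q j m l :: 'b) =
    (if m < l then 0 else if l = m then 1
     else if l \<le> j \<and> j < m then of_nat ((m - 1) choose l) * of_nat ((q + j - m) choose (j - l)) else 0)"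
proof -
  obtain t where t: "q = Suc t" "0 < t" using q(1) by (cases q) auto
  have low: "j + i * (q - 1) = i * q + (j - i)" if "i \<le> j" for i
    using that by (simp add: t)
  have high: "j + i * (q - 1) = (i - 1) * q + (q + j - i)" if "j < i" "i \<le> q" for i
    using that by (cases i) (simp_all add: t)
  consider "m < l" | "l = m" | "l < m" "m \<le> j" | "l \<le> j" "j < m" | "j < l" "l < m"
    by linarith
  thus ?thesis
  proof cases
    case 1
    thus ?thesis by (simp add: block_binomial_def binomial_eq_0 t)
  next
    case 2
    thus ?thesis by (simp add: block_binomial_def)
  next
    case 3
    hence "(block_binomial q j m l :: 'b) = of_nat (m choose l) * of_nat ((j - m) choose (j - l))"
      unfolding block_binomial_def low[OF 3(2)] low[of l, OF less_imp_le[OF less_le_trans[OF 3]]]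
      using q by (intro of_nat_choose_Lucas[OF frob]) auto
    moreover have "(j - m) choose (j - l) = 0" using 3 by (intro binomial_eq_0) simp
    ultimately show ?thesis using 3 by simp
  next
    case 4
    hence "(block_binomial q j m l :: 'b) = of_nat ((m - 1) choose l) * of_nat ((q + j - m) choose (j - l))"
      unfolding block_binomial_def low[OF 4(1)] high[OF 4(2) q(2)]
      using q by (intro of_nat_choose_Lucas[OF frob]) auto
    thus ?thesis using 4 by simp
  next
    case 5
    hence "(block_binomial q j m l :: 'b)
        = of_nat ((m - 1) choose (l - 1)) * of_nat ((q + j - m) choose (q + j - l))"
      unfolding block_binomial_def high[OF less_trans[OF 5] q(2)] high[OF 5(1) less_imp_le[OF less_le_trans[OF 5(2) q(2)]]]
      using q by (intro of_nat_choose_Lucas[OF frob]) auto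
    moreover have "(q + j - m) choose (q + j - l) = 0" using 5 q by (intro binomial_eq_0) simp
    ultimately show ?thesis using 5 by simp
  qed
qed

text \<open>The second binomial coefficient carries the same sign on and off the diagonal, as
  -(-1)^(j+1) = (-1)^(j+2) = (-1)^j.\<close>

lemma of_int_m_entry:
  assumes "i < n" "k < n"
  shows "of_int (m_entry j n q (i + 1) (k + 1)) = ((if i = k then 0 else - block_binomial q j (n - 1 - i) (n - 1 - k))
    + (-1) ^ j * block_binomial q j (n - 1 - i) k :: 'b :: comm_ring_1)"
  by (simp add: m_entry_def block_binomial_def)

section \<open>The image of \<open>t\<close> in \<open>\<complex>\<^sub>\<infinity>\<close>\<close>

context C_infinity
begin

definition T :: 'c where "T = emb (to_ac fls_X_inv)"

lemma abs_one: "dist (1 :: 'c) 0 = 1"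
  using abs_mult[of 1 1] by simp

lemma abs_minus: "dist (- x :: 'c) 0 = dist x 0"
  using dist_diff[of 0 x] by (simp add: dist_commute)

lemma abs_power: "dist (x ^ n :: 'c) 0 = dist x 0 ^ n"
  by (induction n) (simp_all add: abs_one abs_mult)

lemma abs_T_power: "dist (T ^ n) 0 = 2 ^ n"
  by (simp add: abs_power T_def abs_emb dist_fls_def)

lemma T_power_nonzero: "T ^ n \<noteq> 0"
  using abs_T_power[of n] by (metis dist_self zero_neq_one power_not_zero zero_neq_numeral)

lemma T_power_eq_iff: "T ^ a = T ^ b \<longleftrightarrow> a = b"
proof
  assume "T ^ a = T ^ b"
  hence "(2 :: real) ^ a = 2 ^ b" by (metis abs_T_power)
  thus "a = b" by simp
qed simp

lemma T_power_eq_minus: "T ^ a = - (T ^ b) \<Longrightarrow> a = b"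
proof -
  assume "T ^ a = - (T ^ b)"
  hence "(2 :: real) ^ a = 2 ^ b" by (metis abs_T_power abs_minus)
  thus "a = b" by simp
qed

text \<open>Since 2 = 1 + 1 has absolute value at most 1, the term \<open>T ^ b\<close> strictly
  dominates, and the ultrametric inequality gives equality.\<close>

lemma abs_two_T_power_diff:
  assumes "a < b"
  shows "dist (2 * T ^ a - T ^ b) 0 = 2 ^ b"
proof -
  have "dist (2 :: 'c) 0 \<le> 1"
    using abs_add[of 1 1] by (simp add: abs_one)
  hence "dist (2 * T ^ a) 0 \<le> 1 * 2 ^ a"
    unfolding abs_mult abs_T_power by (rule mult_right_mono) simp
  also have "1 * 2 ^ a < (2 :: real) ^ b" using assms by simp
  finally have small: "dist (2 * T ^ a) 0 < 2 ^ b" .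
  have "dist (2 * T ^ a - T ^ b) 0 \<le> 2 ^ b"
    using abs_add[of "2 * T ^ a" "- (T ^ b)"] small by (simp add: abs_minus abs_T_power)
  moreover have "2 ^ b \<le> max (dist (2 * T ^ a) 0) (dist (2 * T ^ a - T ^ b) 0)"
    using abs_add[of "2 * T ^ a" "- (2 * T ^ a - T ^ b)"] abs_minus[of "2 * T ^ a - T ^ b"]
    by (simp add: abs_minus abs_T_power)
  ultimately show ?thesis using small by auto
qed

lemma emb_of_int: "emb (to_ac (fls_const (of_int z))) = of_int z"
  by (simp add: fls_of_int[symmetric] hom_of_int)

lemma of_nat_eq_0_transfer: "of_nat m = (0 :: 'a) \<Longrightarrow> of_nat m = (0 :: 'c)"
  using emb_of_int[of "int m"] by simp

lemma map_M_mat_t: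
  "map_mat (poly_to_C_infinity emb) (M_mat_t j n q) = mat n n (\<lambda>(i, k).
    ((if i = k then 0 else - block_binomial q j (n - 1 - i) (n - 1 - k))
      + (-1) ^ j * block_binomial q j (n - 1 - i) k) * T ^ (j + 1 + k * (q - 1)))"
proof (rule eq_matI, goal_cases)
  case (1 i k)
  hence "map_mat (poly_to_C_infinity emb) (M_mat_t j n q) $$ (i, k)
      = poly_to_C_infinity emb (Polynomial.monom (of_int (m_entry j n q (i + 1) (k + 1))) (j + 1 + k * (q - 1)))"
    by (simp add: M_mat_t_def M_mat_def)
  also have "\<dots> = of_int (m_entry j n q (i + 1) (k + 1)) * T ^ (j + 1 + k * (q - 1))"
    unfolding poly_to_C_infinity_def
    by (subst map_poly_monom) (simp_all add: emb_of_int poly_monom T_def del: of_int_mult of_int_add)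
  finally show ?case
    using 1 by (subst (asm) of_int_m_entry) auto
qed (simp_all add: M_mat_t_def)

end

section \<open>The case distinction\<close>

lemma mat_3_cong:
  assumes "\<forall>i\<in>{0, 1, 2}. \<forall>k\<in>{0, 1, 2}. f i k = g i k"
  shows "mat 3 3 (\<lambda>(i, k). f i k) = mat 3 3 (\<lambda>(i, k). g i k)"
proof -
  have "i \<in> {0, 1, 2}" if "i < 3" for i :: nat using that by auto
  thus ?thesis using assms by (intro eq_matI) auto
qed

lemma mat_4_cong:
  assumes "\<forall>i\<in>{0, 1, 2, 3}. \<forall>k\<in>{0, 1, 2, 3}. f i k = g i k"
  shows "mat 4 4 (\<lambda>(i, k). f i k) = mat 4 4 (\<lambda>(i, k). g i k)"
proof -
  have "i \<in> {0, 1, 2, 3}" if "i < 4" for i :: nat using that by auto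
  thus ?thesis using assms by (intro eq_matI) auto
qed

theorem mainTheorem6:
  fixes emb :: "'a :: {field, finite} fls alg_closure \<Rightarrow> 'c :: {field, complete_space}"
    and q j n :: nat
  assumes "C_infinity emb"
    and "primepow q" and "odd q" and "CARD('a) = q"
    and "j \<le> q - 2"
    and "2 \<le> n" and "n \<le> 4"
  shows "diagonalizable_mat
           (map_mat (poly_to_C_infinity emb) (M_mat_t j n q :: 'a poly mat))"
proof -
  interpret C_infinity emb by fact
  obtain p e where pe: "Factorial_Ring.prime p" "e > 0" "q = p ^ e"
    using assms(2) by (auto simp: primepow_def)
  have "Factorial_Ring.prime CHAR('a)"
    using finite_imp_CHAR_pos[where ?'a = 'a] by (intro prime_CHAR_semidom) auto
  moreover have "CHAR('a) dvd p ^ e"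
    using CHAR_dvd_CARD[where ?'a = 'a] assms(4) pe(3) by simp
  ultimately have "CHAR('a) = p"
    using pe(1) prime_dvd_power primes_dvd_imp_eq by metis
  hence frob: "of_nat (q choose i) = (0 :: 'c)" if "0 < i" "i < q" for i
    using pe that by (intro of_nat_eq_0_transfer of_nat_prime_power_choose[where e = e]) auto
  have "q > 1" using assms(2) by (rule primepow_gt_Suc_0[unfolded One_nat_def[symmetric]])
  hence q3: "q \<ge> 3" using assms(3) by (cases "q = 2") auto
  have q0: "of_nat q = (0 :: 'c)" using frob[of 1] q3 by simp
  obtain h where h: "q = 2 * h + 1" using assms(3) by (elim oddE)
  \<comment> \<open>As \<open>q\<close> is 0 in the field and odd, \<open>2 = 0\<close> would force
    \<open>1 = 0\<close>.\<close>
  have two: "(2 :: 'c) \<noteq> 0"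
  proof
    assume "(2 :: 'c) = 0"
    thus False using q0 by (simp add: h)
  qed
  have h0: "h > 0" and qh: "q - 1 = 2 * h" using h q3 by auto
  define B :: "nat \<Rightarrow> nat \<Rightarrow> 'c" where "B = block_binomial q j"
  \<comment> \<open>From \<open>m < 4\<close> and \<open>q \<ge> 3\<close> follows
    \<open>m \<le> q\<close>, as the digit expansion requires.\<close>
  have B: "B m l = (if m < l then 0 else if l = m then 1
      else if l \<le> j \<and> j < m then of_nat ((m - 1) choose l) * of_nat ((q + j - m) choose (j - l)) else 0)"
    if "m < 4" for m l
    unfolding B_def using that q3 assms(5) by (intro block_binomial_eq[OF frob]) auto
  have Bu: "B m l = 0" if "m < l" "m < 4" for m l using that by (simp add: B)
  have Bd: "B m m = 1" if "m < 4" for m using that by (simp add: B)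
  define d where "d k = T ^ (j + 1 + k * (2 * h))" for k
  have d0: "d k \<noteq> 0" for k unfolding d_def by (rule T_power_nonzero)
  have M: "map_mat (poly_to_C_infinity emb) (M_mat_t j n q :: 'a poly mat) = mat n n (\<lambda>(i, k).
      ((if i = k then 0 else - B (n - 1 - i) (n - 1 - k)) + (-1) ^ j * B (n - 1 - i) k) * d k)"
    unfolding map_M_mat_t B_def d_def qh ..
  have q1: "of_nat (q - Suc 0) = (- 1 :: 'c)" and q2: "of_nat (q - 2) = (- 2 :: 'c)"
    using q0 q3 by (simp_all add: of_nat_diff)
  \<comment> \<open>For \<open>n = 4\<close> this is a common square root of the products of paired
    column powers; it exists because \<open>q - 1 = 2 * h\<close> is even.\<close>
  define w where "w = T ^ (j + 1 + 3 * h)"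
  have w0: "w \<noteq> 0" unfolding w_def by (rule T_power_nonzero)
  have W: "d (Suc 0) * d 2 = w * w" "d 0 * d 3 = w * w"
    by (simp_all add: d_def w_def power_add[symmetric])
  have dd: "d i \<noteq> d k" "d i \<noteq> - d k" if "i \<noteq> k" for i k
  proof -
    have "j + 1 + i * (2 * h) \<noteq> j + 1 + k * (2 * h)" using that h0 by simp
    thus "d i \<noteq> d k" "d i \<noteq> - d k"
      unfolding d_def using T_power_eq_iff T_power_eq_minus by blast+
  qed
  have dw: "d 0 \<noteq> w" "d 0 \<noteq> - w"
  proof -
    have "j + 1 + 0 * (2 * h) \<noteq> j + 1 + 3 * h" using h0 by simp
    thus "d 0 \<noteq> w" "d 0 \<noteq> - w"
      unfolding d_def w_def using T_power_eq_iff T_power_eq_minus by blast+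
  qed
  consider (antidiagonal) "n \<le> j + 1" | (2) "n = 2" "j = 0" | (30) "n = 3" "j = 0" | (31) "n = 3" "j = 1"
    | (40) "n = 4" "j = 0" | (41) "n = 4" "j = 1" | (42) "n = 4" "j = 2"
    using assms(6,7) by linarith
  thus ?thesis
  proof cases
    case antidiagonal
    define x where "x k = (- 1) ^ j * d k" for k
    define u where "u = T ^ (j + 1 + (n - 1) * h)"
    \<comment> \<open>Here every \<open>n - 1 - i\<close> is at most \<open>j\<close>, so
      \<open>B\<close> is the Kronecker delta: the first summand vanishes and the second survives
      exactly on the antidiagonal.\<close>
    have M': "map_mat (poly_to_C_infinity emb) (M_mat_t j n q :: 'a poly mat)
        = mat n n (\<lambda>(i, k). if i = n - 1 - k then x k else 0)"
      unfolding M by (rule eq_matI) (use antidiagonal assms(7) in \<open>auto simp: B x_def\<close>)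
    have sq: "x k * x (n - 1 - k) = u\<^sup>2" if "k < n" for k
    proof -
      have "x k * x (n - 1 - k) = ((- 1) ^ j * (- 1) ^ j) * (d k * d (n - 1 - k))"
        by (simp add: x_def algebra_simps)
      also have "(- 1 :: 'c) ^ j * (- 1) ^ j = 1" by (simp flip: power_mult_distrib)
      also have "d k * d (n - 1 - k) = T ^ (2 * (j + 1) + (k + (n - 1 - k)) * (2 * h))"
        by (simp add: d_def power_add[symmetric] algebra_simps)
      also have "k + (n - 1 - k) = n - 1" using that by simp
      also have "T ^ (2 * (j + 1) + (n - 1) * (2 * h)) = u\<^sup>2"
      proof -
        have "2 * (j + 1) + (n - 1) * (2 * h) = (j + 1 + (n - 1) * h) * 2" by simp
        thus ?thesis unfolding u_def by (simp only: power_mult)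
      qed
      finally show ?thesis by simp
    qed
    have u0: "u \<noteq> 0" unfolding u_def by (rule T_power_nonzero)
    show ?thesis unfolding M' by (rule diagonalizable_mat_antidiagonal[where x = x, OF _ u0 two]) (rule sq)
  next
    case 2
    have M': "map_mat (poly_to_C_infinity emb) (M_mat_t j n q :: 'a poly mat)
        = mat 2 2 (\<lambda>(i, k). [[d 0, 0], [d 0, 0]] ! i ! k)"
      unfolding M unfolding 2 by (rule eq_matI) (auto simp: B 2 less_2_cases_iff)
    show ?thesis unfolding M' by (rule diagonalizable_mat_2_0[OF d0])
  next
    case 30
    have b: "B (Suc 0) 0 = 1" "B 2 0 = 1" "B 2 (Suc 0) = 0"
      by (simp_all add: B 30)
    have M': "map_mat (poly_to_C_infinity emb) (M_mat_t j n q :: 'a poly mat)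
        = mat 3 3 (\<lambda>(i, k). [[d 0, 0, 0], [d 0, d (Suc 0), - d 2], [d 0, 0, 0]] ! i ! k)"
      unfolding M unfolding 30 by (rule mat_3_cong) (simp add: Bu Bd b)
    show ?thesis unfolding M' by (rule diagonalizable_mat_3_0[OF d0 d0 dd(1)]) simp
  next
    case 31
    \<comment> \<open>The low digit of the upper argument for \<open>m = 2\<close> is
      \<open>q - 1\<close>, which is -1 in the field.\<close>
    have b: "B 2 0 = - 1" "B 2 (Suc 0) = 1" "B (Suc 0) 0 = 0"
      by (simp_all add: B 31 q1)
    have M': "map_mat (poly_to_C_infinity emb) (M_mat_t j n q :: 'a poly mat)
        = mat 3 3 (\<lambda>(i, k). [[d 0, - 2 * d (Suc 0), 0], [0, - d (Suc 0), 0], [- d 0, 0, 0]] ! i ! k)"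
      unfolding M unfolding 31 by (rule mat_3_cong) (simp add: Bu Bd b)
    show ?thesis unfolding M' by (rule diagonalizable_mat_3_1[OF d0 d0 dd(2) two]) simp
  next
    case 40
    have b: "B (Suc 0) 0 = 1" "B 2 0 = 1" "B 2 (Suc 0) = 0" "B 3 0 = 1" "B 3 (Suc 0) = 0" "B 3 2 = 0"
      by (simp_all add: B 40)
    have M': "map_mat (poly_to_C_infinity emb) (M_mat_t j n q :: 'a poly mat)
        = mat 4 4 (\<lambda>(i, k). [[d 0, 0, 0, 0], [d 0, 0, d 2, - d 3], [d 0, d (Suc 0), 0, - d 3], [d 0, 0, 0, 0]] ! i ! k)"
      unfolding M unfolding 40 by (rule mat_4_cong) (simp add: Bu Bd b)
    show ?thesis unfolding M' by (rule diagonalizable_mat_4_0[OF W(1) d0 d0 w0 dw two])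
  next
    case 41
    have b: "B 2 0 = - 1" "B 2 (Suc 0) = 1" "B 3 0 = - 2" "B 3 (Suc 0) = 2" "B (Suc 0) 0 = 0" "B 3 2 = 0"
      by (simp_all add: B 41 q1 q2)
    have M': "map_mat (poly_to_C_infinity emb) (M_mat_t j n q :: 'a poly mat)
        = mat 4 4 (\<lambda>(i, k). [[2 * d 0, - 2 * d (Suc 0), - 2 * d 2, d 3], [d 0, - d (Suc 0), - 2 * d 2, d 3],
            [0, - d (Suc 0), 0, 0], [- d 0, 0, 0, 0]] ! i ! k)"
      unfolding M unfolding 41 by (rule mat_4_cong) (simp add: Bu Bd b)
    \<comment> \<open>The eigenvalue \<open>2 * d 0 - d 1\<close> has the absolute value of
      \<open>d 1\<close>, smaller than that of \<open>w\<close>; so it is nonzero and differs from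
      \<open>w\<close> and \<open>- w\<close>.\<close>
    have \<mu>: "dist (2 * d 0 - d (Suc 0)) 0 = 2 ^ (j + 1 + 2 * h)"
      using abs_two_T_power_diff[of "j + 1" "j + 1 + 2 * h"] h0 by (simp add: d_def)
    have nz: "2 * d 0 - d (Suc 0) \<noteq> 0" using \<mu> by auto
    have neq: "2 * d 0 - d (Suc 0) \<noteq> w" "2 * d 0 - d (Suc 0) \<noteq> - w"
    proof -
      have "dist (2 * d 0 - d (Suc 0)) 0 \<noteq> dist w 0" unfolding \<mu> w_def abs_T_power using h0 by simp
      thus "2 * d 0 - d (Suc 0) \<noteq> w" "2 * d 0 - d (Suc 0) \<noteq> - w" by (auto simp: abs_minus)
    qed
    show ?thesis unfolding M' by (rule diagonalizable_mat_4_1[OF W dd(1) d0 w0 two nz neq]) simp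
  next
    case 42
    \<comment> \<open>Modulo \<open>p\<close> the coefficient is (-1)(-2)/2 = 1; the division is
      replaced by cancelling the nonzero factor 2.\<close>
    have "of_nat ((q - 1) choose 2) * 2 = of_nat (q - 1) * (of_nat (q - 2) :: 'c)"
    proof -
      have "((q - 1) choose 2) * 2 = (q - 1) * (q - 1 - 1)"
        unfolding choose_two by (rule dvd_div_mult_self) (use h in simp)
      hence "of_nat (((q - 1) choose 2) * 2) = (of_nat ((q - 1) * (q - 1 - 1)) :: 'c)" by (rule arg_cong)
      thus ?thesis by (simp add: numeral_2_eq_2 mult.commute)
    qed
    hence "of_nat ((q - Suc 0) choose 2) * 2 = (1 * 2 :: 'c)" by (simp add: q1 q2)
    hence c2: "of_nat ((q - Suc 0) choose 2) = (1 :: 'c)" using two by (simp del: mult_1)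
    have b: "B 3 0 = 1" "B 3 (Suc 0) = - 2" "B 3 2 = 1" "B 2 (Suc 0) = 0" "B 2 0 = 0" "B (Suc 0) 0 = 0"
      by (simp_all add: B 42 q1 c2)
    have M': "map_mat (poly_to_C_infinity emb) (M_mat_t j n q :: 'a poly mat)
        = mat 4 4 (\<lambda>(i, k). [[d 0, - 3 * d (Suc 0), 3 * d 2, 0], [0, 0, d 2, 0], [0, d (Suc 0), 0, 0], [d 0, 0, 0, 0]] ! i ! k)"
      unfolding M unfolding 42 by (rule mat_4_cong) (simp add: Bu Bd b)
    show ?thesis unfolding M' by (rule diagonalizable_mat_4_2[OF W(1) d0 d0 w0 dw two])
  qed
qed

end
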